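(* Let $h:\mathbb{R}^m\to\bar{\mathbb{R}}$ be lower semicontinuous, let $c:\mathbb{R}^n\to\mathbb{R}^m$ be continuously differentiable, and let $\bar x\in\mathbb{R}^n$ be a critical point of $h\circ c$ satisfying $\partial^\infty h(c(\bar x))\cap N(\nabla c(\bar x)^* )=\{0\}$. Let $G\subset \mathrm{gph}(\partial h)$ be any closed set. Then there exists $\bar\epsilon>0$ such that for every $\epsilon\in(0,\bar\epsilon)$ there exists $\delta>0$ with the following property. For any $x\in\mathbb{R}^n$ with $|x-\bar x|<\delta$, if there exists a pair $(\hat c,v)\in\mathbb{R}^m\times\mathbb{R}^m$ with $$\mathrm{dist}\big((\hat c,v),G\big)<\epsilon$$ and $$v\in\partial h(\hat c),\quad |\hat c-c(x)|<\delta,\quad \big|h(\hat c)-h(c(\bar x))\big|<\delta,\quad |\nabla c(x)^*v|<\delta,$$ then $G$ is an actively sufficient set for $\bar x$.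
   Context: $\bar{\mathbb{R}}=[-\infty,+\infty]$; $|\cdot|$ is the Euclidean norm and $\mathrm{dist}$ the Euclidean distance to a set ($+\infty$ for the empty set). Subdifferentials are as in Rockafellar–Wets, Variational Analysis: at a point $\bar c$ where $h$ is finite, $v$ is a regular subgradient if $h(c)\ge h(\bar c)+\langle v,c-\bar c\rangle+o(|c-\bar c|)$; $v\in\partial h(\bar c)$ if there are $c_r\to\bar c$ with $h(c_r)\to h(\bar c)$ and regular subgradients $v_r$ of $h$ at $c_r$ with $v_r\to v$; $v\in\partial^\infty h(\bar c)$ (horizon subdifferential) if there are such $c_r$, regular subgradients $v_r$ at $c_r$, and scalars $\lambda_r\downarrow0$ with $\lambda_r v_r\to v$. Where $h$ is not finite, $\partial h=\emptyset$. $\mathrm{gph}(\partial h)=\{(c,v):v\in\partial h(c)\}$. $\nabla c(x)^*$ is the adjoint of the derivative $\nabla c(x):\mathbb{R}^n\to\mathbb{R}^m$, and $N(\cdot)$ denotes null space. A point $\bar x$ is critical for $h\circ c$ if $0\in\partial(h\circ c)(\bar x)$. A multiplier vector for a critical point $\bar x$ is $v\in\mathbb{R}^m$ with $v\in\partial h(c(\bar x))$ and $\nabla c(\bar x)^*v=0$. An actively sufficient set for $\bar x$ is a set $G\subset\mathrm{gph}(\partial h)$ containing a point $(c(\bar x),\bar v)$ where $\bar v$ is a multiplier vector for $\bar x$. *)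

theory Defs
  imports "HOL-Analysis.Analysis" "HOL-Library.Landau_Symbols"
begin

definition lower_semicontinuous :: "('a::topological_space \<Rightarrow> ereal) \<Rightarrow> bool" where
  "lower_semicontinuous h \<longleftrightarrow> (\<forall>x. h x \<le> Liminf (at x) h)"

definition continuously_differentiable ::
    "('a::real_normed_vector \<Rightarrow> 'b::real_normed_vector) \<Rightarrow> bool" where
  "continuously_differentiable c \<longleftrightarrow>
     (\<exists>D :: 'a \<Rightarrow> 'a \<Rightarrow>\<^sub>L 'b.
        (\<forall>x. (c has_derivative blinfun_apply (D x)) (at x)) \<and> continuous_on UNIV D)"

definition deriv_adjoint ::
    "('a::real_inner \<Rightarrow> 'b::real_inner) \<Rightarrow> 'a \<Rightarrow> 'b \<Rightarrow> 'a" where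
  "deriv_adjoint c x = adjoint (frechet_derivative c (at x))"

text \<open>Distance to a set, with value \<open>\<infinity>\<close> for the empty set (where \<^const>\<open>infdist\<close> is \<open>0\<close>).\<close>

definition set_distance :: "'a::metric_space \<Rightarrow> 'a set \<Rightarrow> ereal" where
  "set_distance x A = (INF y\<in>A. ereal (dist x y))"

text \<open>The function \<open>r\<close> is the \<open>o(|c - cbar|)\<close> remainder; as a condition on the limit
  \<open>c \<rightarrow> cbar\<close>, the inequality is only required near \<open>cbar\<close>.\<close>

definition regular_subgradient ::
    "('a::real_inner \<Rightarrow> ereal) \<Rightarrow> 'a \<Rightarrow> 'a \<Rightarrow> bool" where
  "regular_subgradient h cbar v \<longleftrightarrow>
     \<bar>h cbar\<bar> \<noteq> \<infinity> \<and>
     (\<exists>r :: 'a \<Rightarrow> real. r \<in> o[at cbar](\<lambda>c. norm (c - cbar)) \<and>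
        (\<forall>\<^sub>F c in at cbar. h c \<ge> h cbar + ereal (v \<bullet> (c - cbar) + r c)))"

definition subdifferential ::
    "('a::real_inner \<Rightarrow> ereal) \<Rightarrow> 'a \<Rightarrow> 'a set" where
  "subdifferential h cbar =
     {v. \<bar>h cbar\<bar> \<noteq> \<infinity> \<and>
         (\<exists>(cs :: nat \<Rightarrow> 'a) (vs :: nat \<Rightarrow> 'a).
            cs \<longlonglongrightarrow> cbar \<and> (\<lambda>r. h (cs r)) \<longlonglongrightarrow> h cbar \<and>
            (\<forall>r. regular_subgradient h (cs r) (vs r)) \<and> vs \<longlonglongrightarrow> v)}"

definition horizon_subdifferential ::
    "('a::real_inner \<Rightarrow> ereal) \<Rightarrow> 'a \<Rightarrow> 'a set" where
  "horizon_subdifferential h cbar =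
     {v. \<bar>h cbar\<bar> \<noteq> \<infinity> \<and>
         (\<exists>(cs :: nat \<Rightarrow> 'a) (vs :: nat \<Rightarrow> 'a) (lam :: nat \<Rightarrow> real).
            cs \<longlonglongrightarrow> cbar \<and> (\<lambda>r. h (cs r)) \<longlonglongrightarrow> h cbar \<and>
            (\<forall>r. regular_subgradient h (cs r) (vs r)) \<and>
            (\<forall>r. lam r > 0) \<and> lam \<longlonglongrightarrow> 0 \<and> (\<lambda>r. lam r *\<^sub>R vs r) \<longlonglongrightarrow> v)}"

definition gph_subdifferential :: "('a::real_inner \<Rightarrow> ereal) \<Rightarrow> ('a \<times> 'a) set" where
  "gph_subdifferential h = {(c, v). v \<in> subdifferential h c}"

definition critical_point :: "('a::real_inner \<Rightarrow> ereal) \<Rightarrow> 'a \<Rightarrow> bool" where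
  "critical_point f x \<longleftrightarrow> 0 \<in> subdifferential f x"

definition multiplier_vector ::
    "('b::real_inner \<Rightarrow> ereal) \<Rightarrow> ('a::real_inner \<Rightarrow> 'b) \<Rightarrow> 'a \<Rightarrow> 'b \<Rightarrow> bool" where
  "multiplier_vector h c x v \<longleftrightarrow> v \<in> subdifferential h (c x) \<and> deriv_adjoint c x v = 0"

definition actively_sufficient ::
    "('b::real_inner \<Rightarrow> ereal) \<Rightarrow> ('a::real_inner \<Rightarrow> 'b) \<Rightarrow> 'a \<Rightarrow> ('b \<times> 'b) set \<Rightarrow> bool" where
  "actively_sufficient h c x G \<longleftrightarrow>
     G \<subseteq> gph_subdifferential h \<and> (\<exists>v. multiplier_vector h c x v \<and> (c x, v) \<in> G)"

end

theory Submission
  imports Defs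
begin

text \<open>If the conclusion fails, one can pick \<open>x\<^sub>k \<rightarrow> xbar\<close> and subgradients
  \<open>v\<^sub>k \<in> \<partial>h(c\<^sub>k)\<close>, with \<open>c\<^sub>k \<rightarrow> c(xbar)\<close> and \<open>h(c\<^sub>k) \<rightarrow> h(c(xbar))\<close>, such that
  \<open>\<nabla>c(x\<^sub>k)\<^sup>* v\<^sub>k \<rightarrow> 0\<close> and the distance of \<open>(c\<^sub>k, v\<^sub>k)\<close> to \<open>G\<close> tends to \<open>0\<close>. If the \<open>v\<^sub>k\<close> were
  unbounded, a limit of the normalised vectors would be a unit horizon subgradient in the null
  space of \<open>\<nabla>c(xbar)\<^sup>*\<close>, against the constraint qualification. So a subsequence converges to some
  \<open>v\<close>; since \<open>G\<close> is closed it contains \<open>(c(xbar), v)\<close>, and \<open>v\<close> is a multiplier because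
  \<open>G\<close> lies in the graph of \<open>\<partial>h\<close>.\<close>

text \<open>Subgradients exist only where \<open>h\<close> is finite, so convergence of its values
  can be handled by real distances.\<close>

lemma tendsto_ereal_iff_real_of_ereal:
  fixes f :: "'a \<Rightarrow> ereal"
  assumes "\<And>x. \<bar>f x\<bar> \<noteq> \<infinity>" "\<bar>l\<bar> \<noteq> \<infinity>"
  shows "(f \<longlongrightarrow> l) F \<longleftrightarrow> ((\<lambda>x. real_of_ereal (f x)) \<longlongrightarrow> real_of_ereal l) F"
proof -
  have "f = (\<lambda>x. ereal (real_of_ereal (f x)))" "l = ereal (real_of_ereal l)"
    using assms by (auto simp: ereal_real)
  then show ?thesis
    by (metis lim_ereal)
qed

lemma subdifferential_finite: "v \<in> subdifferential h c \<Longrightarrow> \<bar>h c\<bar> \<noteq> \<infinity>"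
  by (simp add: subdifferential_def)

lemma regular_subgradient_finite: "regular_subgradient h c v \<Longrightarrow> \<bar>h c\<bar> \<noteq> \<infinity>"
  by (simp add: regular_subgradient_def)

text \<open>A late enough term of the defining sequences meets all three estimates at once. This
  feeds the diagonal choice for horizon subgradients.\<close>

lemma subdifferential_approx_regular:
  assumes "v \<in> subdifferential h c" "e > 0"
  obtains c' v' where "regular_subgradient h c' v'" "dist c' c < e" "dist v' v < e"
    "dist (real_of_ereal (h c')) (real_of_ereal (h c)) < e"
proof -
  obtain cs vs where cs: "cs \<longlonglongrightarrow> c" "(\<lambda>r. h (cs r)) \<longlonglongrightarrow> h c" "vs \<longlonglongrightarrow> v"
      "\<And>r. regular_subgradient h (cs r) (vs r)" and fin: "\<bar>h c\<bar> \<noteq> \<infinity>"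
    using assms(1) by (auto simp: subdifferential_def)
  have "(\<lambda>r. real_of_ereal (h (cs r))) \<longlonglongrightarrow> real_of_ereal (h c)"
    by (rule iffD1[OF tendsto_ereal_iff_real_of_ereal cs(2)])
       (fact regular_subgradient_finite[OF cs(4)] fin)+
  then have "\<forall>\<^sub>F r in sequentially. dist (cs r) c < e \<and> dist (vs r) v < e \<and>
      dist (real_of_ereal (h (cs r))) (real_of_ereal (h c)) < e"
    using cs(1,3) assms(2) by (intro eventually_conj tendstoD)
  then obtain r where "dist (cs r) c < e" "dist (vs r) v < e"
      "dist (real_of_ereal (h (cs r))) (real_of_ereal (h c)) < e"
    using eventually_happens'[OF sequentially_bot] by blast
  then show ?thesis
    using cs(4) that by blast
qed

lemma tendsto_of_dist_less_inverse_Suc: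
  fixes X Y :: "nat \<Rightarrow> 'a::metric_space"
  assumes "X \<longlonglongrightarrow> l" "\<And>k. dist (Y k) (X k) < inverse (real (Suc k))"
  shows "Y \<longlonglongrightarrow> l"
proof -
  have "(\<lambda>k. inverse (real (Suc k)) + dist (X k) l) \<longlonglongrightarrow> 0 + 0"
    using assms(1) LIMSEQ_inverse_real_of_nat tendsto_dist_iff by (intro tendsto_add) blast+
  then have bound: "(\<lambda>k. inverse (real (Suc k)) + dist (X k) l) \<longlonglongrightarrow> 0"
    by simp
  have "dist (Y k) l \<le> inverse (real (Suc k)) + dist (X k) l" for k
    using assms(2)[of k] dist_triangle[of "Y k" l "X k"] by linarith
  then have "(\<lambda>k. dist (Y k) l) \<longlonglongrightarrow> 0"
    by (intro tendsto_sandwich[OF _ _ tendsto_const bound] always_eventually) auto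
  then show ?thesis
    by (rule iffD2[OF tendsto_dist_iff])
qed

text \<open>Subgradients may replace regular subgradients in the definition of the horizon
  subdifferential.\<close>

lemma horizon_subdifferentialI:
  fixes cs vs :: "nat \<Rightarrow> 'a::real_inner"
  assumes fin: "\<bar>h c\<bar> \<noteq> \<infinity>"
    and cs: "cs \<longlonglongrightarrow> c" and hcs: "(\<lambda>k. h (cs k)) \<longlonglongrightarrow> h c"
    and vs: "\<And>k. vs k \<in> subdifferential h (cs k)"
    and lam: "\<And>k. lam k > 0" "lam \<longlonglongrightarrow> 0" and w: "(\<lambda>k. lam k *\<^sub>R vs k) \<longlonglongrightarrow> w"
  shows "w \<in> horizon_subdifferential h c"
proof -
  \<comment> \<open>Diagonal choice: each pair \<open>(cs k, vs k)\<close> is replaced by a regular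
    one within \<open>1/(k+1)\<close>, so points and values keep their limits.\<close>
  have "\<exists>p. regular_subgradient h (fst p) (snd p) \<and> dist (fst p) (cs k) < inverse (real (Suc k)) \<and>
      dist (snd p) (vs k) < inverse (real (Suc k)) \<and>
      dist (real_of_ereal (h (fst p))) (real_of_ereal (h (cs k))) < inverse (real (Suc k))" for k
    using subdifferential_approx_regular[OF vs, of "inverse (real (Suc k))" k]
    by (metis fst_conv snd_conv inverse_positive_iff_positive of_nat_0_less_iff zero_less_Suc)
  then obtain p where p: "\<And>k. regular_subgradient h (fst (p k)) (snd (p k))"
      "\<And>k. dist (fst (p k)) (cs k) < inverse (real (Suc k))"
      "\<And>k. dist (snd (p k)) (vs k) < inverse (real (Suc k))"
      "\<And>k. dist (real_of_ereal (h (fst (p k)))) (real_of_ereal (h (cs k))) < inverse (real (Suc k))"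
    by metis
  have "(\<lambda>k. fst (p k)) \<longlonglongrightarrow> c"
    using tendsto_of_dist_less_inverse_Suc[OF cs p(2)] .
  moreover have hcs': "(\<lambda>k. real_of_ereal (h (cs k))) \<longlonglongrightarrow> real_of_ereal (h c)"
    by (rule iffD1[OF tendsto_ereal_iff_real_of_ereal hcs])
       (fact subdifferential_finite[OF vs] fin)+
  have "(\<lambda>k. h (fst (p k))) \<longlonglongrightarrow> h c"
    by (rule iffD2[OF tendsto_ereal_iff_real_of_ereal tendsto_of_dist_less_inverse_Suc[OF hcs' p(4)]])
       (fact regular_subgradient_finite[OF p(1)] fin)+
  moreover have "(\<lambda>k. snd (p k) - vs k) \<longlonglongrightarrow> 0"
    using p(3) by (intro tendsto_of_dist_less_inverse_Suc[OF tendsto_const]) (simp add: dist_norm)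
  \<comment> \<open>The replacement error tends to 0 before scaling, hence also after scaling by
    \<open>lam\<close>, and the limit \<open>w\<close> is unchanged.\<close>
  then have "(\<lambda>k. lam k *\<^sub>R vs k + lam k *\<^sub>R (snd (p k) - vs k)) \<longlonglongrightarrow> w + 0 *\<^sub>R 0"
    by (intro tendsto_intros w lam)
  then have "(\<lambda>k. lam k *\<^sub>R snd (p k)) \<longlonglongrightarrow> w"
    by (simp add: algebra_simps)
  ultimately show ?thesis
    unfolding horizon_subdifferential_def using fin p(1) lam
    by (intro CollectI conjI exI[of _ "\<lambda>k. fst (p k)"] exI[of _ "\<lambda>k. snd (p k)"] exI[of _ lam]) auto
qed

lemma continuously_differentiable_continuous:
  assumes "continuously_differentiable c"
  shows "isCont c x"
  using assms has_derivative_continuous unfolding continuously_differentiable_def by blast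

lemma linear_deriv_adjoint:
  fixes c :: "'a::euclidean_space \<Rightarrow> 'b::euclidean_space"
  assumes "continuously_differentiable c"
  shows "linear (deriv_adjoint c x)"
proof -
  have "c differentiable (at x)"
    using assms by (auto simp: continuously_differentiable_def differentiable_def)
  then show ?thesis
    unfolding deriv_adjoint_def by (intro adjoint_linear linear_frechet_derivative)
qed

text \<open>Pairing with a basis vector \<open>i\<close> moves the adjoint onto the derivative: the
  component is \<open>D y i \<bullet> u\<close>, jointly continuous in \<open>y\<close> and
  \<open>u\<close>. In finite dimension components decide convergence.\<close>

lemma tendsto_deriv_adjoint:
  fixes c :: "'a::euclidean_space \<Rightarrow> 'b::euclidean_space"
  assumes "continuously_differentiable c" "(X \<longlongrightarrow> x) F" "(V \<longlongrightarrow> v) F"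
  shows "((\<lambda>k. deriv_adjoint c (X k) (V k)) \<longlongrightarrow> deriv_adjoint c x v) F"
proof -
  obtain D where D: "\<And>x. (c has_derivative blinfun_apply (D x)) (at x)" "continuous_on UNIV D"
    using assms(1) by (auto simp: continuously_differentiable_def)
  have inner_eq: "deriv_adjoint c y u \<bullet> i = D y i \<bullet> u" for y u i
    using adjoint_works[OF has_derivative_linear[OF D(1)], of i y u]
    by (simp add: deriv_adjoint_def inner_commute frechet_derivative_at[OF D(1), symmetric])
  have "((\<lambda>k. D (X k)) \<longlongrightarrow> D x) F"
    using D(2) assms(2) isCont_tendsto_compose
    by (metis continuous_on_eq_continuous_at open_UNIV UNIV_I)
  then have "((\<lambda>k. D (X k) i \<bullet> V k) \<longlongrightarrow> D x i \<bullet> v) F" for i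
    by (intro tendsto_intros assms(3))
  then show ?thesis
    by (subst tendsto_componentwise_iff) (simp add: inner_eq)
qed

text \<open>This is where the constraint qualification enters; the bound makes it possible to
  extract a convergent subsequence of \<open>V\<close>.\<close>

lemma approximate_multipliers_Bseq:
  fixes c :: "'a::euclidean_space \<Rightarrow> 'b::euclidean_space" and V :: "nat \<Rightarrow> 'b"
  assumes c: "continuously_differentiable c"
    and fin: "\<bar>h (c x)\<bar> \<noteq> \<infinity>"
    and cq: "horizon_subdifferential h (c x) \<inter> {v. deriv_adjoint c x v = 0} \<subseteq> {0}"
    and X: "X \<longlonglongrightarrow> x" and C: "C \<longlonglongrightarrow> c x" and hC: "(\<lambda>k. h (C k)) \<longlonglongrightarrow> h (c x)"
    and V: "\<And>k. V k \<in> subdifferential h (C k)"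
    and adj: "(\<lambda>k. deriv_adjoint c (X k) (V k)) \<longlonglongrightarrow> 0"
  shows "Bseq V"
proof (rule ccontr)
  assume "\<not> Bseq V"
  \<comment> \<open>\<open>Bseq\<close> quantifies over positive bounds, hence \<open>Suc n\<close>;
    this later gives \<open>lam n \<le> inverse (Suc n)\<close>. The choice \<open>s\<close> may
    fail to be monotone, but \<open>s n \<ge> n\<close> still sends it to infinity.\<close>
  then have "\<exists>k\<ge>n. norm (V k) > real (Suc n)" for n
    unfolding Bfun_def eventually_sequentially by (metis linorder_not_le of_nat_0_less_iff zero_less_Suc)
  then obtain s where s: "\<And>n. s n \<ge> n" "\<And>n. norm (V (s n)) > real (Suc n)"
    by metis
  have pos: "norm (V (s n)) > 0" for n
    using s(2)[of n] by linarith
  then have "sgn (V (s n)) \<in> sphere 0 1" for n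
    by (simp add: norm_sgn)
  then obtain w t where w: "w \<in> sphere 0 1" "strict_mono t" "(\<lambda>n. sgn (V (s (t n)))) \<longlonglongrightarrow> w"
    using seq_compactE[OF compact_imp_seq_compact[OF compact_sphere], of "\<lambda>n. sgn (V (s n))" 0 1]
    unfolding comp_def by blast
  define q where "q n = s (t n)" for n
  define lam where "lam n = inverse (norm (V (q n)))" for n
  have q: "filterlim q sequentially sequentially"
    unfolding q_def using s(1) seq_suble[OF w(2)]
    by (intro filterlim_at_top_mono[OF filterlim_ident] always_eventually) (meson order_trans)
  have lam_pos: "lam n > 0" for n
    using pos by (simp add: lam_def q_def)
  have "lam n \<le> inverse (real (Suc n))" for n
    unfolding lam_def q_def
    using s(2)[of "t n"] seq_suble[OF w(2), of n] by (intro le_imp_inverse_le) auto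
  then have lam_lim: "lam \<longlonglongrightarrow> 0"
    using lam_pos
    by (intro tendsto_sandwich[OF _ _ tendsto_const LIMSEQ_inverse_real_of_nat] always_eventually)
       (auto intro: less_imp_le)
  have lamV: "(\<lambda>n. lam n *\<^sub>R V (q n)) \<longlonglongrightarrow> w"
    using w(3) by (simp add: lam_def q_def sgn_div_norm)
  have "w \<in> horizon_subdifferential h (c x)"
    using fin filterlim_compose[OF C q] filterlim_compose[OF hC q] V lam_pos lam_lim lamV
    by (rule horizon_subdifferentialI)
  \<comment> \<open>By linearity the scaling moves inside the adjoint, so one sequence tends both to
    0 and to \<open>deriv_adjoint c x w\<close>. As \<open>w\<close> is a unit vector, this
    contradicts \<open>cq\<close>.\<close>
  moreover have "(\<lambda>n. lam n *\<^sub>R deriv_adjoint c (X (q n)) (V (q n))) \<longlonglongrightarrow> 0 *\<^sub>R 0"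
    by (intro tendsto_intros lam_lim filterlim_compose[OF adj q])
  then have "(\<lambda>n. deriv_adjoint c (X (q n)) (lam n *\<^sub>R V (q n))) \<longlonglongrightarrow> 0"
    by (simp add: linear_cmul[OF linear_deriv_adjoint[OF c]])
  then have "deriv_adjoint c x w = 0"
    using tendsto_deriv_adjoint[OF c filterlim_compose[OF X q] lamV] LIMSEQ_unique by blast
  ultimately show False
    using cq w(1) by auto
qed

theorem theorem2p2:
  fixes h :: "real ^ 'm \<Rightarrow> ereal"
    and c :: "real ^ 'n \<Rightarrow> real ^ 'm"
    and xbar :: "real ^ 'n"
    and G :: "((real ^ 'm) \<times> (real ^ 'm)) set"
  assumes "lower_semicontinuous h"
    and "continuously_differentiable c"
    and "critical_point (h \<circ> c) xbar"
    and "horizon_subdifferential h (c xbar) \<inter> {v. deriv_adjoint c xbar v = 0} = {0}"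
    and "G \<subseteq> gph_subdifferential h"
    and "closed G"
  shows "\<exists>epsbar>0. \<forall>eps. 0 < eps \<and> eps < epsbar \<longrightarrow>
    (\<exists>delta>0. \<forall>x. norm (x - xbar) < delta \<longrightarrow>
       (\<exists>chat v. set_distance (chat, v) G < ereal eps \<and>
          v \<in> subdifferential h chat \<and>
          norm (chat - c x) < delta \<and>
          \<bar>h chat - h (c xbar)\<bar> < ereal delta \<and>
          norm (deriv_adjoint c x v) < delta) \<longrightarrow>
       actively_sufficient h c xbar G)"
proof (rule ccontr)
  let ?claim = ?thesis
  assume neg: "\<not> ?claim"
  define e where "e k = inverse (real (Suc k))" for k
  have e_pos: "e k > 0" for k
    by (simp add: e_def)
  have "\<exists>x chat v. norm (x - xbar) < e k \<and> set_distance (chat, v) G < ereal (e k) \<and>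
      v \<in> subdifferential h chat \<and> norm (chat - c x) < e k \<and>
      \<bar>h chat - h (c xbar)\<bar> < ereal (e k) \<and> norm (deriv_adjoint c x v) < e k" for k
  proof (rule ccontr)
    assume none: "\<not> ?thesis"
    \<comment> \<open>With \<open>epsbar\<close> and \<open>delta\<close> both equal to
      \<open>e k\<close>, the premise of the claim would never hold: a distance below
      \<open>eps\<close> is below \<open>e k\<close>, which \<open>none\<close> excludes.\<close>
    have ?claim
    proof (intro exI[of _ "e k"] conjI allI impI e_pos)
      fix eps x
      assume eps: "0 < eps \<and> eps < e k" and x: "norm (x - xbar) < e k"
        and "\<exists>chat v. set_distance (chat, v) G < ereal eps \<and> v \<in> subdifferential h chat \<and>
          norm (chat - c x) < e k \<and> \<bar>h chat - h (c xbar)\<bar> < ereal (e k) \<and>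
          norm (deriv_adjoint c x v) < e k"
      then obtain chat v where cv: "set_distance (chat, v) G < ereal eps"
          "v \<in> subdifferential h chat" "norm (chat - c x) < e k"
          "\<bar>h chat - h (c xbar)\<bar> < ereal (e k)" "norm (deriv_adjoint c x v) < e k"
        by blast
      have "set_distance (chat, v) G < ereal (e k)"
        using cv(1) eps by (meson less_ereal.simps(1) less_trans)
      then show "actively_sufficient h c xbar G"
        using none x cv(2-) by blast
    qed
    then show False
      using neg by contradiction
  qed
  then obtain X C V where X: "\<And>k. norm (X k - xbar) < e k"
    and dG: "\<And>k. set_distance (C k, V k) G < ereal (e k)"
    and V: "\<And>k. V k \<in> subdifferential h (C k)" and C: "\<And>k. norm (C k - c (X k)) < e k"
    and hC: "\<And>k. \<bar>h (C k) - h (c xbar)\<bar> < ereal (e k)"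
    and adj: "\<And>k. norm (deriv_adjoint c (X k) (V k)) < e k"
    by metis
  \<comment> \<open>Criticality of \<open>xbar\<close> makes \<open>h \<circ> c\<close> finite
    there.\<close>
  have fin: "\<bar>h (c xbar)\<bar> \<noteq> \<infinity>"
    using assms(3) subdifferential_finite unfolding critical_point_def by fastforce
  have X_lim: "X \<longlonglongrightarrow> xbar"
    using X by (intro tendsto_of_dist_less_inverse_Suc[OF tendsto_const]) (simp add: dist_norm e_def)
  have "(\<lambda>k. c (X k)) \<longlonglongrightarrow> c xbar"
    using isCont_tendsto_compose[OF continuously_differentiable_continuous[OF assms(2)] X_lim] .
  then have C_lim: "C \<longlonglongrightarrow> c xbar"
    using C by (elim tendsto_of_dist_less_inverse_Suc) (simp add: dist_norm e_def)
  have hC': "dist (real_of_ereal (h (C k))) (real_of_ereal (h (c xbar))) < inverse (real (Suc k))" for k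
    using hC[of k] fin subdifferential_finite[OF V[of k]]
    by (cases "h (C k)"; cases "h (c xbar)") (auto simp: dist_real_def e_def)
  have hC_lim: "(\<lambda>k. h (C k)) \<longlonglongrightarrow> h (c xbar)"
    by (rule iffD2[OF tendsto_ereal_iff_real_of_ereal
          tendsto_of_dist_less_inverse_Suc[OF tendsto_const hC']])
       (fact subdifferential_finite[OF V] fin)+
  have adj_lim: "(\<lambda>k. deriv_adjoint c (X k) (V k)) \<longlonglongrightarrow> 0"
    using adj by (intro tendsto_of_dist_less_inverse_Suc[OF tendsto_const]) (simp add: e_def)
  have "bounded (range V)"
    using approximate_multipliers_Bseq[OF assms(2) fin _ X_lim C_lim hC_lim V adj_lim] assms(4)
    by (simp add: Bseq_eq_bounded)
  then obtain v t where t: "strict_mono t" and Vt: "(\<lambda>n. V (t n)) \<longlonglongrightarrow> v"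
    using bounded_imp_convergent_subsequence[of V] by (auto simp: comp_def)
  have t_lim: "filterlim t sequentially sequentially"
    using t by (rule filterlim_subseq)
  \<comment> \<open>An infimum below \<open>e k\<close> has a member of \<open>G\<close> below
    \<open>e k\<close>; the value \<infinity> for the empty set rules out an empty
    \<open>G\<close>.\<close>
  obtain g where g: "\<And>k. g k \<in> G" "\<And>k. dist (C k, V k) (g k) < e k"
    using dG unfolding set_distance_def INF_less_iff by (metis less_ereal.simps(1))
  \<comment> \<open>Since \<open>n \<le> t n\<close>, the tolerance at index \<open>t n\<close> is
    at most the one at \<open>n\<close>.\<close>
  have "dist (g (t n)) (C (t n), V (t n)) < inverse (real (Suc n))" for n
  proof -
    have "e (t n) \<le> e n"
      unfolding e_def using seq_suble[OF t, of n] by (intro le_imp_inverse_le) auto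
    then show ?thesis
      using g(2)[of "t n"] by (metis dist_commute e_def order_less_le_trans)
  qed
  then have "(\<lambda>n. g (t n)) \<longlonglongrightarrow> (c xbar, v)"
    by (rule tendsto_of_dist_less_inverse_Suc
        [OF tendsto_Pair[OF filterlim_compose[OF C_lim t_lim] Vt]])
  then have "(c xbar, v) \<in> G"
    by (rule closed_sequentially[OF assms(6) g(1)])
  moreover have "deriv_adjoint c xbar v = 0"
    by (rule LIMSEQ_unique[OF tendsto_deriv_adjoint[OF assms(2) filterlim_compose[OF X_lim t_lim] Vt]
          filterlim_compose[OF adj_lim t_lim]])
  ultimately have "actively_sufficient h c xbar G"
    using assms(5)
    by (auto simp: actively_sufficient_def multiplier_vector_def gph_subdifferential_def)
  \<comment> \<open>Active sufficiency of \<open>G\<close> does not mention \<open>eps\<close>,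
    \<open>delta\<close> or \<open>x\<close>, so any positive choices, here 1, now serve.\<close>
  then have ?claim
    by (intro exI[of _ 1] conjI allI impI) auto
  then show False
    using neg by contradiction
qed

end
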